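(* Let $I=[a,b]$ be a compact interval, $g\in\operatorname{CV}_-(I,\mathbb R)$, and let $S\subset BC_g(I,\mathbb R)$. Then $S$ is precompact if and only if the following three conditions hold: (i) $S(t)=\{f(t): f\in S\}$ is bounded for all $t\in I$; (ii) $S$ is $g$-equicontinuous; (iii) $S$ is $g$-stable.
   Context: For an interval $J\subset I$, $\operatorname{var}_gJ$ is the total variation of $g$ on $J$; for $x,y\in I$ with $y\le x$ put $[x,y]:=[y,x]$. $\operatorname{BV}_-(I,\mathbb R)$ is the set of left continuous $g:I\to\mathbb R$ with $\operatorname{var}_gI<\infty$. One-sided limits are denoted $g(x^\pm)$, with $g(a^-):=g(a)$, $g(b^+):=g(b)$. $D_g=\{x\in I: g(x^+)\neq g(x^-)\}$. For $g\in\operatorname{BV}_-(I,\mathbb R)$, $|\mu_g|$ is the positive measure on $I$ determined by $|\mu_g|([x,y))=\operatorname{var}_g[x,y)$ for $x<y$ in $I$ and $|\mu_g|(\{x\})=|g(x^+)-g(x)|$. $\operatorname{CV}_-(I,\mathbb R)$ (functions of controlled variation) is the set of $g\in\operatorname{BV}_-(I,\mathbb R)$ for which there is a closed set $F_g\subset I$ such that $g$ is monotonic on each connected component of $I\setminus F_g$ and $|\mu_g|(F_g\setminus D_g)=0$. The $g$-topology on $I$ is $\tau_g=\{U\subset I:\forall t\in U\ \exists r>0,\ B_g(t,r)\subset U\}$, with $B_g(t,r)=\{s\in I:\operatorname{var}_g[t,s]<r\}$. $BC_g(I,\mathbb R)$ is the space of bounded functions $h:I\to\mathbb R$ that are $g$-continuous,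 i.e. continuous from $(I,\tau_g)$ to $\mathbb R$ with the usual topology, endowed with the supremum norm. Precompact means totally bounded for this norm. $S\subset BC_g(I,\mathbb R)$ is $g$-equicontinuous if for every $\varepsilon>0$ and $t\in I$ there is $\delta>0$ such that $|f(t)-f(s)|<\varepsilon$ for every $f\in S$ and every $s\in I$ with $\operatorname{var}_g[t,s]<\delta$. $S$ is $g$-stable if for every $t\in[a,b)\cap D_g$ and every $\varepsilon>0$ there are $\delta>0$ and a finite covering $\{X_k\}_{k=1}^m$ of $[t,t+\delta)\cap I$ such that $|f(x)-f(y)|<\varepsilon$ for every $f\in S$, every $x,y\in X_k$ and every $k=1,\dots,m$. *)

theory Defs
  imports "HOL-Analysis.Analysis"
begin

text \<open>
  The interval \<open>I\<close> is \<open>{a..b}\<close>.  A function \<open>g : I \<rightarrow> \<real>\<close> is represented by a total function on the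
  reals, of which only the values on \<open>{a..b}\<close> matter in the definitions below.
\<close>

definition variation :: "(real \<Rightarrow> real) \<Rightarrow> real set \<Rightarrow> ennreal" where
  "variation g J =
     (SUP (n, x) \<in> {(n :: nat, x :: nat \<Rightarrow> real). mono_on {..n} x \<and> x ` {..n} \<subseteq> J}.
        ennreal (\<Sum>i<n. \<bar>g (x (Suc i)) - g (x i)\<bar>))"

definition BV_left :: "real \<Rightarrow> real \<Rightarrow> (real \<Rightarrow> real) set" where
  "BV_left a b = {g. (\<forall>t\<in>{a<..b}. (g \<longlongrightarrow> g t) (at_left t)) \<and> variation g {a..b} < \<infinity>}"

definition left_lim :: "real \<Rightarrow> real \<Rightarrow> (real \<Rightarrow> real) \<Rightarrow> real \<Rightarrow> real" where
  "left_lim a b g t = (if t = a then g a else Lim (at_left t) g)"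

definition right_lim :: "real \<Rightarrow> real \<Rightarrow> (real \<Rightarrow> real) \<Rightarrow> real \<Rightarrow> real" where
  "right_lim a b g t = (if t = b then g b else Lim (at_right t) g)"

definition jump_set :: "real \<Rightarrow> real \<Rightarrow> (real \<Rightarrow> real) \<Rightarrow> real set" where
  "jump_set a b g = {t \<in> {a..b}. right_lim a b g t \<noteq> left_lim a b g t}"

text \<open>
  For \<open>g \<in> BV_left a b\<close> there is exactly one Borel measure on \<open>{a..b}\<close> with the two properties
  below.  The second one only adds information at \<open>x = b\<close>, where it gives mass \<open>0\<close>.
\<close>

definition var_measure :: "real \<Rightarrow> real \<Rightarrow> (real \<Rightarrow> real) \<Rightarrow> real measure" where
  "var_measure a b g =
     (THE M. sets M = sets (restrict_space borel {a..b}) \<and>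
        (\<forall>x\<in>{a..b}. \<forall>y\<in>{a..b}. x < y \<longrightarrow> emeasure M {x..<y} = variation g {x..<y}) \<and>
        (\<forall>x\<in>{a..b}. emeasure M {x} = ennreal \<bar>right_lim a b g x - g x\<bar>))"

definition CV_left :: "real \<Rightarrow> real \<Rightarrow> (real \<Rightarrow> real) set" where
  "CV_left a b = {g \<in> BV_left a b. \<exists>F. closed F \<and> F \<subseteq> {a..b} \<and>
     (\<forall>C \<in> components ({a..b} - F). mono_on C g \<or> antimono_on C g) \<and>
     F - jump_set a b g \<in> null_sets (var_measure a b g)}"

text \<open>
  On the reals, \<open>closed_segment t s\<close> is \<open>{min t s..max t s}\<close>.
\<close>

definition g_ball :: "real \<Rightarrow> real \<Rightarrow> (real \<Rightarrow> real) \<Rightarrow> real \<Rightarrow> real \<Rightarrow> real set" where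
  "g_ball a b g t r = {s \<in> {a..b}. variation g (closed_segment t s) < ennreal r}"

definition g_topology :: "real \<Rightarrow> real \<Rightarrow> (real \<Rightarrow> real) \<Rightarrow> real topology" where
  "g_topology a b g = topology (\<lambda>U. U \<subseteq> {a..b} \<and> (\<forall>t\<in>U. \<exists>r>0. g_ball a b g t r \<subseteq> U))"

lemma openin_g_topology:
  "openin (g_topology a b g) U \<longleftrightarrow> U \<subseteq> {a..b} \<and> (\<forall>t\<in>U. \<exists>r>0. g_ball a b g t r \<subseteq> U)"
proof -
  have mono: "g_ball a b g t r \<subseteq> g_ball a b g t r'" if "r \<le> r'" for t r r'
    using that by (auto simp: g_ball_def intro: order_less_le_trans ennreal_leI)
  have "istopology (\<lambda>U. U \<subseteq> {a..b} \<and> (\<forall>t\<in>U. \<exists>r>0. g_ball a b g t r \<subseteq> U))"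
    unfolding istopology_def
  proof (intro conjI allI impI)
    fix U V
    assume U: "U \<subseteq> {a..b} \<and> (\<forall>t\<in>U. \<exists>r>0. g_ball a b g t r \<subseteq> U)"
      and V: "V \<subseteq> {a..b} \<and> (\<forall>t\<in>V. \<exists>r>0. g_ball a b g t r \<subseteq> V)"
    show "U \<inter> V \<subseteq> {a..b}" using U by blast
    show "\<forall>t\<in>U \<inter> V. \<exists>r>0. g_ball a b g t r \<subseteq> U \<inter> V"
    proof
      fix t assume "t \<in> U \<inter> V"
      then obtain r s where "r > 0" "s > 0" "g_ball a b g t r \<subseteq> U" "g_ball a b g t s \<subseteq> V"
        using U V by blast
      then show "\<exists>r>0. g_ball a b g t r \<subseteq> U \<inter> V"
        using mono[of "min r s" r t] mono[of "min r s" s t]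
        by (intro exI[of _ "min r s"]) auto
    qed
  next
    fix K :: "real set set"
    assume K: "\<forall>U\<in>K. U \<subseteq> {a..b} \<and> (\<forall>t\<in>U. \<exists>r>0. g_ball a b g t r \<subseteq> U)"
    show "\<Union>K \<subseteq> {a..b}" using K by blast
    show "\<forall>t\<in>\<Union>K. \<exists>r>0. g_ball a b g t r \<subseteq> \<Union>K"
      using K by (meson UnionE Union_upper order_trans)
  qed
  then show ?thesis
    by (simp add: g_topology_def)
qed

lemma topspace_g_topology [simp]: "topspace (g_topology a b g) = {a..b}"
proof -
  have "openin (g_topology a b g) {a..b}"
    by (auto simp: openin_g_topology g_ball_def intro: exI[of _ 1])
  then show ?thesis
    using openin_g_topology[of a b g "topspace (g_topology a b g)"] openin_subset by auto
qed

text \<open>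
  \<open>BC_g(I, \<real>)\<close>: the elements of \<^const>\<open>cfunspace\<close> are the bounded continuous functions that are
  extensional on \<open>{a..b}\<close>, so they correspond exactly to functions \<open>I \<rightarrow> \<real>\<close>; its metric is the
  supremum distance over \<open>{a..b}\<close>.
\<close>

definition BC_g :: "real \<Rightarrow> real \<Rightarrow> (real \<Rightarrow> real) \<Rightarrow> (real \<Rightarrow> real) metric" where
  "BC_g a b g = cfunspace (g_topology a b g) euclidean_metric"

definition g_precompact :: "real \<Rightarrow> real \<Rightarrow> (real \<Rightarrow> real) \<Rightarrow> (real \<Rightarrow> real) set \<Rightarrow> bool" where
  "g_precompact a b g S \<longleftrightarrow>
     Metric_space.mtotally_bounded (mspace (BC_g a b g)) (mdist (BC_g a b g)) S"

definition g_equicontinuous :: "real \<Rightarrow> real \<Rightarrow> (real \<Rightarrow> real) \<Rightarrow> (real \<Rightarrow> real) set \<Rightarrow> bool" where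
  "g_equicontinuous a b g S \<longleftrightarrow>
     (\<forall>\<epsilon>>0. \<forall>t\<in>{a..b}. \<exists>\<delta>>0. \<forall>f\<in>S. \<forall>s\<in>{a..b}.
        variation g (closed_segment t s) < ennreal \<delta> \<longrightarrow> \<bar>f t - f s\<bar> < \<epsilon>)"

definition g_stable :: "real \<Rightarrow> real \<Rightarrow> (real \<Rightarrow> real) \<Rightarrow> (real \<Rightarrow> real) set \<Rightarrow> bool" where
  "g_stable a b g S \<longleftrightarrow>
     (\<forall>t \<in> {a..<b} \<inter> jump_set a b g. \<forall>\<epsilon>>0. \<exists>\<delta>>0. \<exists>\<X>. finite \<X> \<and> (\<forall>X\<in>\<X>. X \<subseteq> {a..b}) \<and>
        {t..<t + \<delta>} \<inter> {a..b} \<subseteq> \<Union>\<X> \<and>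
        (\<forall>f\<in>S. \<forall>X\<in>\<X>. \<forall>x\<in>X. \<forall>y\<in>X. \<bar>f x - f y\<bar> < \<epsilon>))"

end

theory Submission
  imports Defs
begin

text \<open>
  The heart of the matter is a symmetry between points and functions.  A pointwise bounded family
  \<open>S\<close> of bounded functions on \<open>I = {a..b}\<close> is totally bounded in the supremum norm exactly if, for
  every \<open>\<epsilon>\<close>, the interval has a finite cover on whose members every \<open>f \<in> S\<close> oscillates by less than
  \<open>\<epsilon>\<close> (\<open>g_precompact_iff_finite_covers\<close>).  In one direction a finite net \<open>K\<close> of \<open>S\<close> maps \<open>I\<close> to a
  bounded subset of \<open>\<real>\<^sup>K\<close>, and pulling back a partition of it into small pieces gives the cover; in
  the other, a set \<open>T\<close> with one point from every nonempty member of the cover maps \<open>S\<close> to a bounded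
  subset of \<open>\<real>\<^sup>T\<close>, and pulling back small pieces gives the net.  Both are the pigeonhole argument
  \<open>finite_cover_small_oscillation\<close>.

  A precompact \<open>S\<close> is therefore \<open>g\<close>-stable at once, as a global cover is also a local one; it is
  \<open>g\<close>-equicontinuous by the usual \<open>\<epsilon>/3\<close> argument.

  For the converse, finite covers are built locally and glued by compactness of \<open>I\<close> in its usual
  topology (\<open>equicontinuous_stable_imp_finite_covers\<close>).  Equicontinuity controls the points \<open>s\<close> for
  which the variation of \<open>g\<close> between \<open>t\<close> and \<open>s\<close> is small, so the question is on which side of \<open>t\<close>
  nearby points, in the usual sense, have this property.  The variation of a function of bounded
  variation up to \<open>t\<close> is continuous from a side on which the function itself is
  (\<open>variation_small_at_left\<close>, \<open>variation_small_at_right\<close>).  As \<open>g\<close> is left continuous, this settles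
  the left side of every point, and the right side of every point outside the jump set; on the right
  of a jump the cover is provided by \<open>g\<close>-stability.
\<close>

section \<open>Small oscillation on finite covers\<close>

text \<open>
  The vector \<open>(F k x)\<^sub>k\<close> ranges over a bounded set, so rounding its entries to multiples of \<open>\<epsilon>\<close>
  leaves finitely many values; the fibres of the rounding map form the cover.
\<close>

lemma finite_cover_small_oscillation:
  fixes F :: "'k \<Rightarrow> 'x \<Rightarrow> real"
  assumes "finite K" and bdd: "\<And>k. k \<in> K \<Longrightarrow> bounded (F k ` A)" and "\<epsilon> > 0"
  shows "\<exists>\<X>. finite \<X> \<and> \<Union>\<X> = A \<and> {} \<notin> \<X> \<and>
    (\<forall>k\<in>K. \<forall>X\<in>\<X>. \<forall>x\<in>X. \<forall>y\<in>X. \<bar>F k x - F k y\<bar> < \<epsilon>)"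
proof -
  \<comment> \<open>Extensional functions on \<open>K\<close>, so that the rounded vectors lie in a finite product set.\<close>
  define \<Phi> where "\<Phi> x = restrict (\<lambda>k. \<lfloor>F k x / \<epsilon>\<rfloor>) K" for x
  define \<X> where "\<X> = (\<lambda>x. {y \<in> A. \<Phi> y = \<Phi> x}) ` A"
  have "finite ((\<lambda>x. \<lfloor>F k x / \<epsilon>\<rfloor>) ` A)" if k: "k \<in> K" for k
  proof -
    obtain B where B: "\<And>x. x \<in> A \<Longrightarrow> \<bar>F k x\<bar> \<le> B"
      using bdd[OF k] by (auto simp: bounded_iff)
    have "(\<lambda>x. \<lfloor>F k x / \<epsilon>\<rfloor>) ` A \<subseteq> {\<lfloor>- B / \<epsilon>\<rfloor>..\<lfloor>B / \<epsilon>\<rfloor>}"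
    proof
      fix v assume "v \<in> (\<lambda>x. \<lfloor>F k x / \<epsilon>\<rfloor>) ` A"
      then obtain x where x: "x \<in> A" "v = \<lfloor>F k x / \<epsilon>\<rfloor>" by blast
      have "- B / \<epsilon> \<le> F k x / \<epsilon>" "F k x / \<epsilon> \<le> B / \<epsilon>"
        using B[OF x(1)] \<open>\<epsilon> > 0\<close> by (intro divide_right_mono; linarith)+
      then show "v \<in> {\<lfloor>- B / \<epsilon>\<rfloor>..\<lfloor>B / \<epsilon>\<rfloor>}"
        unfolding x(2) atLeastAtMost_iff by (intro conjI floor_mono)
    qed
    then show ?thesis by (rule finite_subset) simp
  qed
  then have "finite (PiE K (\<lambda>k. (\<lambda>x. \<lfloor>F k x / \<epsilon>\<rfloor>) ` A))"
    using \<open>finite K\<close> by (intro finite_PiE) auto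
  moreover have "\<Phi> ` A \<subseteq> PiE K (\<lambda>k. (\<lambda>x. \<lfloor>F k x / \<epsilon>\<rfloor>) ` A)"
    by (auto simp: \<Phi>_def)
  ultimately have "finite (\<Phi> ` A)" by (rule finite_subset[rotated])
  then have "finite ((\<lambda>v. {y \<in> A. \<Phi> y = v}) ` \<Phi> ` A)" by blast
  moreover have "\<X> = (\<lambda>v. {y \<in> A. \<Phi> y = v}) ` \<Phi> ` A"
    by (auto simp: \<X>_def)
  ultimately have "finite \<X>" by simp
  moreover have "\<Union>\<X> = A" "{} \<notin> \<X>" by (auto simp: \<X>_def)
  moreover have "\<bar>F k x - F k y\<bar> < \<epsilon>" if "X \<in> \<X>" "x \<in> X" "y \<in> X" "k \<in> K" for X x y k
  proof -
    have "\<Phi> x k = \<Phi> y k" using that by (auto simp: \<X>_def)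
    then have "\<lfloor>F k x / \<epsilon>\<rfloor> = \<lfloor>F k y / \<epsilon>\<rfloor>" using \<open>k \<in> K\<close> by (simp add: \<Phi>_def)
    then have "\<bar>F k x / \<epsilon> - F k y / \<epsilon>\<bar> < 1"
      by linarith
    then have "\<bar>(F k x - F k y) / \<epsilon>\<bar> < 1" by (simp add: diff_divide_distrib)
    then show ?thesis using \<open>\<epsilon> > 0\<close> by (simp add: abs_divide)
  qed
  ultimately show ?thesis by blast
qed

section \<open>Precompactness in the space of bounded \<open>g\<close>-continuous functions\<close>

lemma BC_g_bounded:
  assumes "f \<in> mspace (BC_g a b g)"
  shows "bounded (f ` {a..b})"
  using assms by (simp add: BC_g_def)

lemma BC_g_continuous:
  assumes "f \<in> mspace (BC_g a b g)" "t \<in> {a..b}" "\<epsilon> > 0"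
  obtains \<delta> where "\<delta> > 0"
    "\<And>s. \<lbrakk>s \<in> {a..b}; variation g (closed_segment t s) < ennreal \<delta>\<rbrakk> \<Longrightarrow> \<bar>f t - f s\<bar> < \<epsilon>"
proof -
  have "continuous_map (g_topology a b g) euclidean f"
    using assms by (simp add: BC_g_def)
  then have "openin (g_topology a b g) {s \<in> topspace (g_topology a b g). f s \<in> ball (f t) \<epsilon>}"
    by (rule openin_continuous_map_preimage) simp
  then obtain \<delta> where "\<delta> > 0" "g_ball a b g t \<delta> \<subseteq> {s \<in> {a..b}. f s \<in> ball (f t) \<epsilon>}"
    using assms by (auto simp: openin_g_topology)
  then show thesis
    by (intro that[of \<delta>]) (auto simp: g_ball_def dist_real_def subset_iff)
qed

lemma g_precompact_net:
  assumes "g_precompact a b g S" "S \<subseteq> mspace (BC_g a b g)" "\<epsilon> > 0"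
  obtains K where "finite K" "K \<subseteq> S"
    "\<And>f. f \<in> S \<Longrightarrow> \<exists>h\<in>K. \<forall>x\<in>{a..b}. \<bar>f x - h x\<bar> \<le> \<epsilon>"
proof -
  interpret Metric_space "mspace (BC_g a b g)" "mdist (BC_g a b g)" by simp
  obtain K where K: "finite K" "K \<subseteq> S" "S \<subseteq> (\<Union>x\<in>K. mball x \<epsilon>)"
    using assms(1)[unfolded g_precompact_def mtotally_bounded_def, rule_format, OF assms(3)]
    by (elim exE conjE)
  have "\<exists>h\<in>K. \<forall>x\<in>{a..b}. \<bar>f x - h x\<bar> \<le> \<epsilon>" if "f \<in> S" for f
  proof -
    from subsetD[OF K(3) that] obtain h where h: "h \<in> K" "f \<in> mball h \<epsilon>"
      by (elim UN_E)
    have "\<bar>f x - h x\<bar> \<le> \<epsilon>" if "x \<in> {a..b}" for x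
    proof -
      have "f \<in> mspace (BC_g a b g)" "h \<in> mspace (BC_g a b g)" "mdist (BC_g a b g) h f \<le> \<epsilon>"
        using h(2) by simp_all
      then have "dist (h x) (f x) \<le> \<epsilon>"
        using mdist_cfunspace_imp_mdist_le[of h "g_topology a b g" euclidean_metric f \<epsilon> x] that
        unfolding BC_g_def topspace_g_topology mdist_euclidean_metric by blast
      then show ?thesis by (simp add: dist_real_def abs_minus_commute)
    qed
    with h show ?thesis by blast
  qed
  from that[OF K(1,2) this] show thesis .
qed

text \<open>
  Passing from a net to a cover costs \<open>\<epsilon>/3\<close> for the oscillation of the members of the net and twice
  \<open>\<epsilon>/3\<close> for the distance to the net.  In the converse direction \<open>f x\<close> and \<open>h x\<close> are compared through
  a sample point \<open>t\<close> in the same member of the cover as \<open>x\<close>.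
\<close>

lemma g_precompact_iff_finite_covers:
  assumes S: "S \<subseteq> mspace (BC_g a b g)"
  shows "g_precompact a b g S \<longleftrightarrow>
    (\<forall>t\<in>{a..b}. bounded {f t |f. f \<in> S}) \<and>
    (\<forall>\<epsilon>>0. \<exists>\<X>. finite \<X> \<and> \<Union>\<X> = {a..b} \<and>
       (\<forall>f\<in>S. \<forall>X\<in>\<X>. \<forall>x\<in>X. \<forall>y\<in>X. \<bar>f x - f y\<bar> < \<epsilon>))"
    (is "_ \<longleftrightarrow> ?bdd \<and> ?covers")
proof (intro iffI conjI)
  assume pre: "g_precompact a b g S"
  show ?bdd
  proof
    fix t assume t: "t \<in> {a..b}"
    obtain K where K: "finite K" "K \<subseteq> S"
      "\<And>f. f \<in> S \<Longrightarrow> \<exists>h\<in>K. \<forall>x\<in>{a..b}. \<bar>f x - h x\<bar> \<le> 1"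
      using g_precompact_net[OF pre S, of 1] by auto
    have "{f t |f. f \<in> S} \<subseteq> (\<Union>h\<in>K. cball (h t) 1)"
      using K(3) t by (fastforce simp: dist_real_def abs_minus_commute)
    moreover have "bounded (\<Union>h\<in>K. cball (h t) 1)" using K(1) by (intro bounded_UN) auto
    ultimately show "bounded {f t |f. f \<in> S}" by (rule bounded_subset[rotated])
  qed
  show ?covers
  proof (intro allI impI)
    fix \<epsilon> :: real assume "\<epsilon> > 0"
    obtain K where K: "finite K" "K \<subseteq> S"
      "\<And>f. f \<in> S \<Longrightarrow> \<exists>h\<in>K. \<forall>x\<in>{a..b}. \<bar>f x - h x\<bar> \<le> \<epsilon> / 3"
      using g_precompact_net[OF pre S, of "\<epsilon> / 3"] \<open>\<epsilon> > 0\<close> by auto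
    have "bounded (h ` {a..b})" if "h \<in> K" for h
      using that K(2) S BC_g_bounded by blast
    moreover have "\<epsilon> / 3 > 0" using \<open>\<epsilon> > 0\<close> by simp
    ultimately have "\<exists>\<X>. finite \<X> \<and> \<Union>\<X> = {a..b} \<and> {} \<notin> \<X> \<and>
        (\<forall>h\<in>K. \<forall>X\<in>\<X>. \<forall>x\<in>X. \<forall>y\<in>X. \<bar>h x - h y\<bar> < \<epsilon> / 3)"
      by (rule finite_cover_small_oscillation[OF K(1)])
    then obtain \<X> where \<X>: "finite \<X>" "\<Union>\<X> = {a..b}"
      "\<forall>h\<in>K. \<forall>X\<in>\<X>. \<forall>x\<in>X. \<forall>y\<in>X. \<bar>h x - h y\<bar> < \<epsilon> / 3"
      by blast
    have "\<bar>f x - f y\<bar> < \<epsilon>" if "f \<in> S" "X \<in> \<X>" "x \<in> X" "y \<in> X" for f X x y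
    proof -
      from K(3)[OF that(1)]
      obtain h where h: "h \<in> K" "\<forall>x\<in>{a..b}. \<bar>f x - h x\<bar> \<le> \<epsilon> / 3" by blast
      moreover have "x \<in> {a..b}" "y \<in> {a..b}" using \<X>(2) that by blast+
      ultimately have "\<bar>f x - h x\<bar> \<le> \<epsilon> / 3" "\<bar>f y - h y\<bar> \<le> \<epsilon> / 3" by blast+
      with \<X>(3)[rule_format, OF h(1) that(2-4)] show ?thesis by linarith
    qed
    with \<X> show "\<exists>\<X>. finite \<X> \<and> \<Union>\<X> = {a..b} \<and>
       (\<forall>f\<in>S. \<forall>X\<in>\<X>. \<forall>x\<in>X. \<forall>y\<in>X. \<bar>f x - f y\<bar> < \<epsilon>)"
      by (intro exI[of _ \<X>] conjI ballI)
  qed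
next
  interpret Metric_space "mspace (BC_g a b g)" "mdist (BC_g a b g)" by simp
  assume "?bdd \<and> ?covers"
  then have ?bdd ?covers by auto
  show "g_precompact a b g S"
    unfolding g_precompact_def mtotally_bounded_def
  proof (intro allI impI)
    fix \<epsilon> :: real assume "\<epsilon> > 0"
    then have pos: "\<epsilon> / 4 > 0" by simp
    obtain \<X> where \<X>: "finite \<X>" "\<Union>\<X> = {a..b}"
      "\<forall>f\<in>S. \<forall>X\<in>\<X>. \<forall>x\<in>X. \<forall>y\<in>X. \<bar>f x - f y\<bar> < \<epsilon> / 4"
      using \<open>?covers\<close>[rule_format, OF pos] by (elim exE conjE)
    define T where "T = (\<lambda>X. SOME t. t \<in> X) ` (\<X> - {{}})"
    have T: "\<exists>t\<in>T. t \<in> X" if "X \<in> \<X>" "x \<in> X" for X x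
      using that someI[of "\<lambda>t. t \<in> X" x] by (auto simp: T_def)
    have "T \<subseteq> {a..b}"
    proof
      fix t assume "t \<in> T"
      then obtain X where "X \<in> \<X>" "X \<noteq> {}" "t = (SOME t. t \<in> X)" by (auto simp: T_def)
      then have "t \<in> X" by (simp add: some_in_eq)
      with \<open>X \<in> \<X>\<close> \<X>(2) show "t \<in> {a..b}" by blast
    qed
    have "finite T" using \<X>(1) by (simp add: T_def)
    moreover have "bounded ((\<lambda>f. f t) ` S)" if "t \<in> T" for t
    proof -
      have "(\<lambda>f. f t) ` S = {f t |f. f \<in> S}" by auto
      then show ?thesis using \<open>?bdd\<close> \<open>T \<subseteq> {a..b}\<close> that by auto
    qed
    ultimately have "\<exists>\<Y>. finite \<Y> \<and> \<Union>\<Y> = S \<and> {} \<notin> \<Y> \<and>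
        (\<forall>t\<in>T. \<forall>Y\<in>\<Y>. \<forall>f\<in>Y. \<forall>h\<in>Y. \<bar>f t - h t\<bar> < \<epsilon> / 4)"
      by (rule finite_cover_small_oscillation[OF _ _ pos])
    then obtain \<Y> where \<Y>: "finite \<Y>" "\<Union>\<Y> = S" "{} \<notin> \<Y>"
      "\<forall>t\<in>T. \<forall>Y\<in>\<Y>. \<forall>f\<in>Y. \<forall>h\<in>Y. \<bar>f t - h t\<bar> < \<epsilon> / 4"
      by blast
    define K where "K = (\<lambda>Y. SOME f. f \<in> Y) ` \<Y>"
    have some: "(SOME f. f \<in> Y) \<in> Y" if "Y \<in> \<Y>" for Y
      using that \<Y>(3) by (metis some_in_eq)
    have "finite K" using \<Y>(1) by (simp add: K_def)
    moreover have "K \<subseteq> S" using some \<Y>(2) by (auto simp: K_def)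
    moreover have "S \<subseteq> (\<Union>h\<in>K. mball h \<epsilon>)"
    proof
      fix f assume "f \<in> S"
      then obtain Y where Y: "Y \<in> \<Y>" "f \<in> Y" using \<Y>(2) by blast
      define h where "h = (SOME f. f \<in> Y)"
      have h: "h \<in> Y" "h \<in> K" using some Y by (auto simp: h_def K_def)
      then have "h \<in> S" using \<Y>(2) Y by blast
      have "\<bar>h x - f x\<bar> \<le> 3 * \<epsilon> / 4" if x: "x \<in> {a..b}" for x
      proof -
        obtain X where X: "X \<in> \<X>" "x \<in> X" using x \<X>(2) by blast
        then obtain t where t: "t \<in> T" "t \<in> X" using T by blast
        have "\<bar>f x - f t\<bar> < \<epsilon> / 4" "\<bar>h x - h t\<bar> < \<epsilon> / 4"
          using \<X>(3) X t \<open>f \<in> S\<close> \<open>h \<in> S\<close> by simp_all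
        moreover have "\<bar>f t - h t\<bar> < \<epsilon> / 4"
          using \<Y>(4) t Y h by simp
        ultimately show ?thesis by linarith
      qed
      then have "mdist (BC_g a b g) h f \<le> 3 * \<epsilon> / 4"
        unfolding BC_g_def using \<open>\<epsilon> > 0\<close>
        by (intro mdist_cfunspace_le) (auto simp: dist_real_def)
      then have "f \<in> mball h \<epsilon>" using \<open>f \<in> S\<close> \<open>h \<in> S\<close> S \<open>\<epsilon> > 0\<close> by auto
      with h show "f \<in> (\<Union>h\<in>K. mball h \<epsilon>)" by blast
    qed
    ultimately show "\<exists>K. finite K \<and> K \<subseteq> S \<and> S \<subseteq> (\<Union>x\<in>K. mball x \<epsilon>)" by blast
  qed
qed

lemma g_precompact_imp_g_equicontinuous:
  assumes pre: "g_precompact a b g S" and S: "S \<subseteq> mspace (BC_g a b g)"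
  shows "g_equicontinuous a b g S"
  unfolding g_equicontinuous_def
proof (intro allI impI ballI)
  fix \<epsilon> t :: real assume "\<epsilon> > 0" and t: "t \<in> {a..b}"
  obtain K where K: "finite K" "K \<subseteq> S"
    "\<And>f. f \<in> S \<Longrightarrow> \<exists>h\<in>K. \<forall>x\<in>{a..b}. \<bar>f x - h x\<bar> \<le> \<epsilon> / 3"
    using g_precompact_net[OF pre S, of "\<epsilon> / 3"] \<open>\<epsilon> > 0\<close> by auto
  have "\<exists>\<delta>>0. \<forall>s\<in>{a..b}. variation g (closed_segment t s) < ennreal \<delta> \<longrightarrow> \<bar>h t - h s\<bar> < \<epsilon> / 3"
    if "h \<in> K" for h
    using BC_g_continuous[of h a b g t "\<epsilon> / 3"] that K(2) S t \<open>\<epsilon> > 0\<close>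
    by (metis divide_pos_pos subsetD zero_less_numeral)
  then obtain d where d: "\<And>h. h \<in> K \<Longrightarrow> d h > 0"
    "\<And>h s. \<lbrakk>h \<in> K; s \<in> {a..b}; variation g (closed_segment t s) < ennreal (d h)\<rbrakk>
       \<Longrightarrow> \<bar>h t - h s\<bar> < \<epsilon> / 3"
    by metis
  \<comment> \<open>The extra \<open>1\<close> keeps the minimum meaningful when \<open>S\<close>, and hence the net, is empty.\<close>
  define \<delta> where "\<delta> = Min (insert 1 (d ` K))"
  have "\<delta> > 0" using K(1) d(1) by (auto simp: \<delta>_def)
  moreover have "\<bar>f t - f s\<bar> < \<epsilon>"
    if "f \<in> S" "s \<in> {a..b}" and s: "variation g (closed_segment t s) < ennreal \<delta>" for f s
  proof -
    from K(3)[OF that(1)]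
    obtain h where h: "h \<in> K" "\<forall>x\<in>{a..b}. \<bar>f x - h x\<bar> \<le> \<epsilon> / 3" by blast
    have "\<delta> \<le> d h" using K(1) h(1) by (auto simp: \<delta>_def)
    with s have "variation g (closed_segment t s) < ennreal (d h)"
      by (meson ennreal_leI order_less_le_trans)
    then have "\<bar>h t - h s\<bar> < \<epsilon> / 3" using d(2) h(1) that(2) by blast
    moreover have "\<bar>f t - h t\<bar> \<le> \<epsilon> / 3" "\<bar>f s - h s\<bar> \<le> \<epsilon> / 3" using h(2) t that(2) by blast+
    ultimately show ?thesis by linarith
  qed
  ultimately show "\<exists>\<delta>>0. \<forall>f\<in>S. \<forall>s\<in>{a..b}.
      variation g (closed_segment t s) < ennreal \<delta> \<longrightarrow> \<bar>f t - f s\<bar> < \<epsilon>" by blast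
qed

section \<open>Variation\<close>

lemma variation_mono:
  assumes "J \<subseteq> J'"
  shows "variation g J \<le> variation g J'"
  unfolding variation_def using assms by (intro SUP_subset_mono) auto

lemma variation_upper:
  assumes "mono_on {..n} x" "x ` {..n} \<subseteq> J"
  shows "ennreal (\<Sum>i<n. \<bar>g (x (Suc i)) - g (x i)\<bar>) \<le> variation g J"
  unfolding variation_def using assms by (intro SUP_upper2[of "(n, x)"]) auto

lemma variation_least:
  assumes "\<And>n x. \<lbrakk>mono_on {..n} x; x ` {..n} \<subseteq> J\<rbrakk>
    \<Longrightarrow> ennreal (\<Sum>i<n. \<bar>g (x (Suc i)) - g (x i)\<bar>) \<le> c"
  shows "variation g J \<le> c"
  unfolding variation_def using assms by (intro SUP_least) auto

lemma abs_diff_le_variation: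
  assumes "s \<le> t" "s \<in> J" "t \<in> J"
  shows "ennreal \<bar>g t - g s\<bar> \<le> variation g J"
proof -
  let ?x = "\<lambda>i :: nat. if i = 0 then s else t"
  have "mono_on {..1} ?x" using assms(1) by (intro mono_onI) simp
  moreover have "?x ` {..1} \<subseteq> J" using assms(2,3) by (simp add: image_subset_iff)
  ultimately have "ennreal (\<Sum>i<1. \<bar>g (?x (Suc i)) - g (?x i)\<bar>) \<le> variation g J"
    by (rule variation_upper)
  then show ?thesis by simp
qed

text \<open>
  Partitions of \<open>J\<close> and of \<open>J'\<close> are concatenated; the increment between the two is discarded.
\<close>

lemma variation_superadditive:
  assumes "\<And>x y. \<lbrakk>x \<in> J; y \<in> J'\<rbrakk> \<Longrightarrow> x \<le> y"
  shows "variation g J + variation g J' \<le> variation g (J \<union> J')"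
proof (cases "J = {} \<or> J' = {}")
  case True
  have "variation g {} = 0" by (simp add: variation_def bot_ennreal)
  with True show ?thesis by auto
next
  case False
  let ?P = "\<lambda>J. {(n :: nat, x :: nat \<Rightarrow> real). mono_on {..n} x \<and> x ` {..n} \<subseteq> J}"
  let ?s = "\<lambda>(n, x). ennreal (\<Sum>i<n. \<bar>g (x (Suc i)) - g (x i)\<bar>)"
  have ne: "?P J \<noteq> {}" if "J \<noteq> {}" for J
  proof -
    from that obtain j where "j \<in> J" by blast
    then have "(0, \<lambda>_. j) \<in> ?P J" by (auto simp: mono_on_def)
    then show ?thesis by blast
  qed
  have key: "?s p + ?s q \<le> variation g (J \<union> J')" if p: "p \<in> ?P J" and q: "q \<in> ?P J'" for p q
  proof -
    obtain n x where p': "p = (n, x)" "mono_on {..n} x" "x ` {..n} \<subseteq> J" using p by auto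
    obtain m y where q': "q = (m, y)" "mono_on {..m} y" "y ` {..m} \<subseteq> J'" using q by auto
    \<comment> \<open>\<open>n\<close> increments from \<open>x\<close>, one step from \<open>x n\<close> to \<open>y 0\<close>, then \<open>m\<close> increments from \<open>y\<close>.\<close>
    define z where "z i = (if i \<le> n then x i else y (i - Suc n))" for i
    have "mono_on {..n + Suc m} z"
    proof (intro mono_onI)
      fix i j assume ij: "i \<in> {..n + Suc m}" "j \<in> {..n + Suc m}" "i \<le> j"
      consider "j \<le> n" | "i \<le> n" "n < j" | "n < i" by linarith
      then show "z i \<le> z j"
      proof cases
        case 1 then show ?thesis using ij p'(2) by (auto simp: z_def mono_on_def)
      next
        case 2
        then have "x i \<in> J" "y (j - Suc n) \<in> J'" using ij p'(3) q'(3) by auto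
        then show ?thesis using 2 assms by (auto simp: z_def)
      next
        case 3
        then have "i - Suc n \<le> j - Suc n" "i - Suc n \<le> m" "j - Suc n \<le> m" using ij by auto
        then have "y (i - Suc n) \<le> y (j - Suc n)" by (intro mono_onD[OF q'(2)]) simp_all
        then show ?thesis using 3 ij by (simp add: z_def)
      qed
    qed
    moreover have "z ` {..n + Suc m} \<subseteq> J \<union> J'"
    proof (rule image_subsetI)
      fix i assume "i \<in> {..n + Suc m}"
      then show "z i \<in> J \<union> J'"
        using p'(3) q'(3) by (cases "i \<le> n") (simp_all add: z_def image_subset_iff)
    qed
    ultimately have "ennreal (\<Sum>i<n + Suc m. \<bar>g (z (Suc i)) - g (z i)\<bar>) \<le> variation g (J \<union> J')"
      by (rule variation_upper)
    moreover have "(\<Sum>i<n. \<bar>g (x (Suc i)) - g (x i)\<bar>) + (\<Sum>i<m. \<bar>g (y (Suc i)) - g (y i)\<bar>)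
      \<le> (\<Sum>i<n + Suc m. \<bar>g (z (Suc i)) - g (z i)\<bar>)"
    proof -
      have split: "(\<Sum>i<n + k. f i) = (\<Sum>i<n. f i) + (\<Sum>i<k. f (n + i))"
        for k and f :: "nat \<Rightarrow> real"
        by (induction k) simp_all
      have "(\<Sum>i<n + Suc m. \<bar>g (z (Suc i)) - g (z i)\<bar>) =
        (\<Sum>i<n. \<bar>g (z (Suc i)) - g (z i)\<bar>) + (\<Sum>i<Suc m. \<bar>g (z (Suc (n + i))) - g (z (n + i))\<bar>)"
        by (rule split)
      also have "(\<Sum>i<n. \<bar>g (z (Suc i)) - g (z i)\<bar>) = (\<Sum>i<n. \<bar>g (x (Suc i)) - g (x i)\<bar>)"
        by (intro sum.cong) (auto simp: z_def)
      also have "(\<Sum>i<Suc m. \<bar>g (z (Suc (n + i))) - g (z (n + i))\<bar>) =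
        \<bar>g (y 0) - g (x n)\<bar> + (\<Sum>i<m. \<bar>g (y (Suc i)) - g (y i)\<bar>)"
        by (subst sum.lessThan_Suc_shift) (simp add: z_def)
      finally show ?thesis by simp
    qed
    ultimately have "ennreal ((\<Sum>i<n. \<bar>g (x (Suc i)) - g (x i)\<bar>) + (\<Sum>i<m. \<bar>g (y (Suc i)) - g (y i)\<bar>))
      \<le> variation g (J \<union> J')"
      by (meson ennreal_leI order_trans)
    then show ?thesis
      unfolding p'(1) q'(1) prod.case by (subst (asm) ennreal_plus) (auto intro: sum_nonneg)
  qed
  have shift: "c + variation g J' = (SUP q\<in>?P J'. c + ?s q)" for c
    unfolding variation_def[of g J'] by (intro ennreal_SUP_add_right ne) (use False in simp)
  have "variation g J + variation g J' = (SUP p\<in>?P J. ?s p + variation g J')"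
    unfolding variation_def[of g J]
    by (intro ennreal_SUP_add_left[symmetric] ne) (use False in simp)
  also have "\<dots> = (SUP p\<in>?P J. SUP q\<in>?P J'. ?s p + ?s q)"
    by (intro SUP_cong refl shift)
  also have "\<dots> \<le> variation g (J \<union> J')"
    using key by (intro SUP_least)
  finally show ?thesis .
qed

lemma variation_split:
  assumes "r \<le> s" "s \<le> t"
  shows "variation g {r..s} + variation g {s..t} \<le> variation g {r..t}"
proof -
  have "{r..s} \<union> {s..t} = {r..t}" using assms by auto
  then show ?thesis using variation_superadditive[of "{r..s}" "{s..t}" g] by auto
qed

text \<open>
  The variation is a supremum of sums over finitely many points, and each such sum is continuous in
  the values of the function, so a bound on the variation survives pointwise limits.  The maps \<open>c s\<close>
  are monotone in order that they carry partitions of \<open>J\<close> to partitions.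
\<close>

lemma variation_lower_semicontinuous:
  assumes "F \<noteq> bot"
    and lim: "\<And>y. y \<in> J \<Longrightarrow> ((\<lambda>s. g (c s y)) \<longlongrightarrow> g y) F"
    and approx: "\<forall>\<^sub>F s in F. mono_on J (c s) \<and> variation g (c s ` J) \<le> L"
  shows "variation g J \<le> L"
proof (rule variation_least)
  fix n :: nat and x :: "nat \<Rightarrow> real"
  assume x: "mono_on {..n} x" "x ` {..n} \<subseteq> J"
  have mem: "x i \<in> J" if "i \<le> n" for i using x(2) that by (simp add: image_subset_iff)
  let ?S = "\<lambda>s. \<Sum>i<n. \<bar>g (c s (x (Suc i))) - g (c s (x i))\<bar>"
  have "((\<lambda>s. ennreal (?S s)) \<longlongrightarrow> ennreal (\<Sum>i<n. \<bar>g (x (Suc i)) - g (x i)\<bar>)) F"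
    by (intro tendsto_intros lim mem) auto
  moreover have "\<forall>\<^sub>F s in F. ennreal (?S s) \<le> L"
    using approx
  proof (rule eventually_mono)
    fix s assume s: "mono_on J (c s) \<and> variation g (c s ` J) \<le> L"
    have "mono_on {..n} (\<lambda>i. c s (x i))"
      by (intro mono_onI mono_onD[OF conjunct1[OF s]] mono_onD[OF x(1)] mem) simp_all
    moreover have "(\<lambda>i. c s (x i)) ` {..n} \<subseteq> c s ` J" using mem by (simp add: image_subset_iff)
    ultimately have "ennreal (?S s) \<le> variation g (c s ` J)" by (rule variation_upper)
    with s show "ennreal (?S s) \<le> L" by (blast intro: order_trans)
  qed
  ultimately show "ennreal (\<Sum>i<n. \<bar>g (x (Suc i)) - g (x i)\<bar>) \<le> L"
    using \<open>F \<noteq> bot\<close> by (intro tendsto_upperbound) auto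
qed

text \<open>
  Clamping partitions of \<open>{a..t}\<close> to \<open>{a..s}\<close> and letting \<open>s\<close> tend to \<open>t\<close> shows that the variation on
  \<open>{a..t}\<close> is the supremum of the variations on \<open>{a..s}\<close>.  If a fixed amount of variation always
  remained on \<open>{s..t}\<close>, then by superadditivity this finite number would exceed itself.
\<close>

lemma variation_small_at_left:
  assumes "a < t" and fin: "variation g {a..t} < \<infinity>"
    and lim: "(g \<longlongrightarrow> g t) (at_left t)" and "\<delta> > 0"
  obtains s where "a \<le> s" "s < t" "variation g {s..t} < ennreal \<delta>"
proof -
  define L where "L = (SUP s\<in>{a..<t}. variation g {a..s})"
  have "variation g {a..t} \<le> L"
  proof (rule variation_lower_semicontinuous[where c = "\<lambda>s y. min y s" and F = "at_left t"])
    fix y assume y: "y \<in> {a..t}"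
    show "((\<lambda>s. g (min y s)) \<longlongrightarrow> g y) (at_left t)"
    proof (cases "y = t")
      case True
      have "\<forall>\<^sub>F s in at_left t. g (min y s) = g s"
        unfolding True by (auto simp: eventually_at_filter min_def)
      then show ?thesis using lim True by (simp add: tendsto_cong)
    next
      case False
      then have "y < t" using y by simp
      then have "\<forall>\<^sub>F s in at_left t. g (min y s) = g y"
        by (intro eventually_mono[OF eventually_at_left_real]) auto
      then show ?thesis by (rule tendsto_eventually)
    qed
  next
    show "\<forall>\<^sub>F s in at_left t. mono_on {a..t} (\<lambda>y. min y s) \<and>
        variation g ((\<lambda>y. min y s) ` {a..t}) \<le> L"
      using eventually_at_left_real[OF \<open>a < t\<close>]
    proof (rule eventually_mono)
      fix s assume s: "s \<in> {a<..<t}"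
      have "(\<lambda>y. min y s) ` {a..t} \<subseteq> {a..s}"
        using s by (simp add: image_subset_iff min.coboundedI1 min.coboundedI2)
      then have "variation g ((\<lambda>y. min y s) ` {a..t}) \<le> variation g {a..s}"
        by (rule variation_mono)
      also have "\<dots> \<le> L" unfolding L_def using s by (intro SUP_upper) auto
      finally show "mono_on {a..t} (\<lambda>y. min y s) \<and> variation g ((\<lambda>y. min y s) ` {a..t}) \<le> L"
        by (intro conjI mono_onI min.mono order_refl)
    qed
  qed simp
  have "\<exists>s\<in>{a..<t}. variation g {s..t} < ennreal \<delta>"
  proof (rule ccontr)
    assume "\<not> ?thesis"
    then have large: "ennreal \<delta> \<le> variation g {s..t}" if "s \<in> {a..<t}" for s
      using that by (meson not_le)
    have "L + ennreal \<delta> = (SUP s\<in>{a..<t}. variation g {a..s} + ennreal \<delta>)"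
      unfolding L_def using \<open>a < t\<close> by (subst ennreal_SUP_add_left) auto
    also have "\<dots> \<le> variation g {a..t}"
    proof (rule SUP_least)
      fix s assume s: "s \<in> {a..<t}"
      have "variation g {a..s} + ennreal \<delta> \<le> variation g {a..s} + variation g {s..t}"
        using large[OF s] by (rule add_left_mono)
      also have "\<dots> \<le> variation g {a..t}" using s by (intro variation_split) auto
      finally show "variation g {a..s} + ennreal \<delta> \<le> variation g {a..t}" .
    qed
    finally have "L + ennreal \<delta> \<le> variation g {a..t}" .
    with add_right_mono[OF \<open>variation g {a..t} \<le> L\<close>, of "ennreal \<delta>"]
    have "variation g {a..t} + ennreal \<delta> \<le> variation g {a..t} + 0"
      unfolding add_0_right by (rule order_trans)
    then have "ennreal \<delta> \<le> 0"
      using fin by (subst (asm) ennreal_add_left_cancel_le) auto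
    then show False using \<open>\<delta> > 0\<close> by auto
  qed
  then show thesis using that by auto
qed

text \<open>
  The mirror image of the preceding lemma, with partitions clamped from below.
\<close>

lemma variation_small_at_right:
  assumes "t < b" and fin: "variation g {t..b} < \<infinity>"
    and lim: "(g \<longlongrightarrow> g t) (at_right t)" and "\<delta> > 0"
  obtains s where "t < s" "s \<le> b" "variation g {t..s} < ennreal \<delta>"
proof -
  define L where "L = (SUP s\<in>{t<..b}. variation g {s..b})"
  have "variation g {t..b} \<le> L"
  proof (rule variation_lower_semicontinuous[where c = "\<lambda>s y. max y s" and F = "at_right t"])
    fix y assume y: "y \<in> {t..b}"
    show "((\<lambda>s. g (max y s)) \<longlongrightarrow> g y) (at_right t)"
    proof (cases "y = t")
      case True
      have "\<forall>\<^sub>F s in at_right t. g (max y s) = g s"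
        unfolding True by (auto simp: eventually_at_filter max_def)
      then show ?thesis using lim True by (simp add: tendsto_cong)
    next
      case False
      then have "t < y" using y by simp
      then have "\<forall>\<^sub>F s in at_right t. g (max y s) = g y"
        by (intro eventually_mono[OF eventually_at_right_real]) auto
      then show ?thesis by (rule tendsto_eventually)
    qed
  next
    show "\<forall>\<^sub>F s in at_right t. mono_on {t..b} (\<lambda>y. max y s) \<and>
        variation g ((\<lambda>y. max y s) ` {t..b}) \<le> L"
      using eventually_at_right_real[OF \<open>t < b\<close>]
    proof (rule eventually_mono)
      fix s assume s: "s \<in> {t<..<b}"
      have "(\<lambda>y. max y s) ` {t..b} \<subseteq> {s..b}"
        using s by (simp add: image_subset_iff max.coboundedI1 max.coboundedI2)
      then have "variation g ((\<lambda>y. max y s) ` {t..b}) \<le> variation g {s..b}"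
        by (rule variation_mono)
      also have "\<dots> \<le> L" unfolding L_def using s by (intro SUP_upper) auto
      finally show "mono_on {t..b} (\<lambda>y. max y s) \<and> variation g ((\<lambda>y. max y s) ` {t..b}) \<le> L"
        by (intro conjI mono_onI max.mono order_refl)
    qed
  qed simp
  have "\<exists>s\<in>{t<..b}. variation g {t..s} < ennreal \<delta>"
  proof (rule ccontr)
    assume "\<not> ?thesis"
    then have large: "ennreal \<delta> \<le> variation g {t..s}" if "s \<in> {t<..b}" for s
      using that by (meson not_le)
    have "ennreal \<delta> + L = (SUP s\<in>{t<..b}. ennreal \<delta> + variation g {s..b})"
      unfolding L_def using \<open>t < b\<close> by (subst ennreal_SUP_add_right) auto
    also have "\<dots> \<le> variation g {t..b}"
    proof (rule SUP_least)
      fix s assume s: "s \<in> {t<..b}"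
      have "ennreal \<delta> + variation g {s..b} \<le> variation g {t..s} + variation g {s..b}"
        using large[OF s] by (rule add_right_mono)
      also have "\<dots> \<le> variation g {t..b}" using s by (intro variation_split) auto
      finally show "ennreal \<delta> + variation g {s..b} \<le> variation g {t..b}" .
    qed
    finally have "L + ennreal \<delta> \<le> variation g {t..b}" by (simp only: add.commute)
    with add_right_mono[OF \<open>variation g {t..b} \<le> L\<close>, of "ennreal \<delta>"]
    have "variation g {t..b} + ennreal \<delta> \<le> variation g {t..b} + 0"
      unfolding add_0_right by (rule order_trans)
    then have "ennreal \<delta> \<le> 0"
      using fin by (subst (asm) ennreal_add_left_cancel_le) auto
    then show False using \<open>\<delta> > 0\<close> by auto
  qed
  then show thesis using that by auto
qed

lemma antimono_bounded_imp_right_limit: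
  fixes h :: "real \<Rightarrow> real"
  assumes "t < b" and anti: "antimono_on {t<..b} h" and bdd: "\<And>s. s \<in> {t<..b} \<Longrightarrow> h s \<le> B"
  shows "\<exists>l. (h \<longlongrightarrow> l) (at_right t)"
proof
  let ?l = "SUP s\<in>{t<..b}. h s"
  have above: "bdd_above (h ` {t<..b})" using bdd by (intro bdd_aboveI2)
  show "(h \<longlongrightarrow> ?l) (at_right t)"
  proof (rule increasing_tendsto)
    show "\<forall>\<^sub>F s in at_right t. h s \<le> ?l"
      using eventually_at_right_real[OF \<open>t < b\<close>] above
      by (auto elim!: eventually_mono intro!: cSUP_upper)
    fix y assume "y < ?l"
    then obtain r where r: "r \<in> {t<..b}" "y < h r"
      using above \<open>t < b\<close> by (subst (asm) less_cSUP_iff) auto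
    then have "\<forall>\<^sub>F s in at_right t. s \<in> {t<..<r}" by (intro eventually_at_right_real) auto
    then show "\<forall>\<^sub>F s in at_right t. y < h s"
    proof (rule eventually_mono)
      fix s assume "s \<in> {t<..<r}"
      then have "h r \<le> h s" using anti r(1) by (auto simp: monotone_on_def)
      with r(2) show "y < h s" by simp
    qed
  qed
qed

text \<open>
  This is the Jordan decomposition: with \<open>w s\<close> the variation on \<open>{s..b}\<close>, both \<open>w\<close> and \<open>w + g\<close> are
  decreasing and bounded, and \<open>g\<close> is their difference.
\<close>

lemma finite_variation_imp_right_limit:
  assumes "t < b" and fin: "variation g {t..b} < \<infinity>"
  shows "\<exists>l. (g \<longlongrightarrow> l) (at_right t)"
proof -
  define w where "w s = enn2real (variation g {s..b})" for s
  have fin': "variation g J < \<infinity>" if "J \<subseteq> {t..b}" for J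
    using variation_mono[OF that] fin by (rule order_le_less_trans)
  have w: "ennreal (w s) = variation g {s..b}" if "t \<le> s" for s
    using fin'[of "{s..b}"] that by (auto simp: w_def)
  have diff: "\<bar>g s - g r\<bar> \<le> w r - w s" if "t \<le> r" "r \<le> s" "s \<le> b" for r s
  proof -
    have "ennreal (\<bar>g s - g r\<bar> + w s) = ennreal \<bar>g s - g r\<bar> + variation g {s..b}"
      using that w[of s] by (subst ennreal_plus) (auto simp: w_def)
    also have "\<dots> \<le> variation g {r..s} + variation g {s..b}"
      using that by (intro add_right_mono abs_diff_le_variation) auto
    also have "\<dots> \<le> ennreal (w r)" using that w[of r] variation_split[of r s b g] by simp
    finally show ?thesis by (subst (asm) ennreal_le_iff) (auto simp: w_def)
  qed
  have "antimono_on {t<..b} w"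
  proof (intro monotone_onI)
    fix r s assume "r \<in> {t<..b}" "s \<in> {t<..b}" "r \<le> s"
    then show "w s \<le> w r" using diff[of r s] by auto
  qed
  moreover have "w s \<le> w t" if "s \<in> {t<..b}" for s
    using diff[of t s] that by simp
  ultimately obtain l where l: "(w \<longlongrightarrow> l) (at_right t)"
    using antimono_bounded_imp_right_limit[OF \<open>t < b\<close>] by blast
  have "antimono_on {t<..b} (\<lambda>s. w s + g s)"
  proof (intro monotone_onI)
    fix r s assume "r \<in> {t<..b}" "s \<in> {t<..b}" "r \<le> s"
    then show "w s + g s \<le> w r + g r" using diff[of r s] by auto
  qed
  moreover have "w s + g s \<le> w t + g t" if "s \<in> {t<..b}" for s
    using diff[of t s] that by simp
  ultimately obtain l' where "((\<lambda>s. w s + g s) \<longlongrightarrow> l') (at_right t)"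
    using antimono_bounded_imp_right_limit[OF \<open>t < b\<close>] by blast
  from tendsto_diff[OF this l] show ?thesis by auto
qed

text \<open>
  The one-sided limits in the jump set are values of \<^const>\<open>Lim\<close>, which say something about \<open>g\<close>
  only where the limits exist.  Bounded variation supplies the right limit.
\<close>

lemma BV_left_tendsto_at_right:
  assumes g: "g \<in> BV_left a b" and t: "t \<in> {a..<b}" "t \<notin> jump_set a b g"
  shows "(g \<longlongrightarrow> g t) (at_right t)"
proof -
  have "variation g {t..b} < \<infinity>"
    using g t variation_mono[of "{t..b}" "{a..b}" g] by (auto simp: BV_left_def)
  then obtain l where l: "(g \<longlongrightarrow> l) (at_right t)"
    using finite_variation_imp_right_limit[of t b g] t by auto
  have "left_lim a b g t = g t"
  proof (cases "t = a")
    case False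
    then have "(g \<longlongrightarrow> g t) (at_left t)" using g t by (auto simp: BV_left_def)
    then show ?thesis using False by (simp add: left_lim_def tendsto_Lim)
  qed (simp add: left_lim_def)
  moreover have "right_lim a b g t = l"
    using l t by (simp add: right_lim_def tendsto_Lim)
  ultimately have "l = g t" using t by (auto simp: jump_set_def)
  with l show ?thesis by simp
qed

section \<open>From local to global covers\<close>

lemma small_oscillation_at_left:
  assumes g: "g \<in> BV_left a b" and equi: "g_equicontinuous a b g S"
    and t: "t \<in> {a..b}" and "\<epsilon> > 0"
  obtains r where "r < t" "\<And>f x y. \<lbrakk>f \<in> S; x \<in> {r<..t} \<inter> {a..b}; y \<in> {r<..t} \<inter> {a..b}\<rbrakk>
    \<Longrightarrow> \<bar>f x - f y\<bar> < \<epsilon>"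
proof (cases "t = a")
  case True
  then show ?thesis using \<open>\<epsilon> > 0\<close> by (intro that[of "a - 1"]) auto
next
  case False
  obtain \<delta> where "\<delta> > 0" and \<delta>: "\<And>f s. \<lbrakk>f \<in> S; s \<in> {a..b};
      variation g (closed_segment t s) < ennreal \<delta>\<rbrakk> \<Longrightarrow> \<bar>f t - f s\<bar> < \<epsilon> / 2"
    using equi t \<open>\<epsilon> > 0\<close> unfolding g_equicontinuous_def by (meson half_gt_zero)
  have "variation g {a..t} < \<infinity>"
    using g t variation_mono[of "{a..t}" "{a..b}" g] by (auto simp: BV_left_def)
  moreover have "(g \<longlongrightarrow> g t) (at_left t)" using g t False by (auto simp: BV_left_def)
  ultimately obtain r where r: "a \<le> r" "r < t" "variation g {r..t} < ennreal \<delta>"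
    using variation_small_at_left[of a t g \<delta>] t False \<open>\<delta> > 0\<close> by auto
  have near: "\<bar>f t - f x\<bar> < \<epsilon> / 2" if "f \<in> S" "x \<in> {r<..t} \<inter> {a..b}" for f x
  proof (rule \<delta>)
    have "closed_segment t x \<subseteq> {r..t}" using that by (auto simp: closed_segment_eq_real_ivl)
    from variation_mono[OF this] r(3)
    show "variation g (closed_segment t x) < ennreal \<delta>" by (rule order_le_less_trans)
  qed (use that in auto)
  show ?thesis
  proof (rule that[OF r(2)])
    fix f x y assume "f \<in> S" "x \<in> {r<..t} \<inter> {a..b}" "y \<in> {r<..t} \<inter> {a..b}"
    then show "\<bar>f x - f y\<bar> < \<epsilon>" using near[of f x] near[of f y] by linarith
  qed
qed

text \<open>
  At a jump the cover comes from stability.  Elsewhere a single interval suffices, because the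
  variation of \<open>g\<close> just to the right of \<open>t\<close> is small.
\<close>

lemma finite_cover_at_right:
  assumes g: "g \<in> BV_left a b" and equi: "g_equicontinuous a b g S"
    and stable: "g_stable a b g S" and t: "t \<in> {a..b}" and "\<epsilon> > 0"
  obtains r \<X> where "t < r" "finite \<X>" "\<Union>\<X> \<subseteq> {a..b}" "{t..<r} \<inter> {a..b} \<subseteq> \<Union>\<X>"
    "\<And>f X x y. \<lbrakk>f \<in> S; X \<in> \<X>; x \<in> X; y \<in> X\<rbrakk> \<Longrightarrow> \<bar>f x - f y\<bar> < \<epsilon>"
proof -
  consider "t = b" | "t < b" "t \<in> jump_set a b g" | "t < b" "t \<notin> jump_set a b g"
    using t by fastforce
  then show thesis
  proof cases
    case 1
    \<comment> \<open>There is no point of \<open>{a..b}\<close> to the right of \<open>b\<close>.\<close>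
    then show ?thesis using \<open>\<epsilon> > 0\<close> t by (intro that[of "b + 1" "{{b}}"]) auto
  next
    case 2
    then obtain \<delta> \<X> where \<X>: "\<delta> > 0" "finite \<X>" "\<forall>X\<in>\<X>. X \<subseteq> {a..b}"
      "{t..<t + \<delta>} \<inter> {a..b} \<subseteq> \<Union>\<X>" "\<forall>f\<in>S. \<forall>X\<in>\<X>. \<forall>x\<in>X. \<forall>y\<in>X. \<bar>f x - f y\<bar> < \<epsilon>"
      using stable[unfolded g_stable_def, rule_format, of t \<epsilon>] t \<open>\<epsilon> > 0\<close> by auto
    show ?thesis
    proof (rule that[of "t + \<delta>" \<X>])
      show "\<Union>\<X> \<subseteq> {a..b}" using \<X>(3) by (intro Union_least) simp
      fix f X x y assume "f \<in> S" "X \<in> \<X>" "x \<in> X" "y \<in> X"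
      then show "\<bar>f x - f y\<bar> < \<epsilon>" using \<X>(5) by simp
    qed (use \<X> in simp_all)
  next
    case 3
    obtain \<delta> where "\<delta> > 0" and \<delta>: "\<And>f s. \<lbrakk>f \<in> S; s \<in> {a..b};
        variation g (closed_segment t s) < ennreal \<delta>\<rbrakk> \<Longrightarrow> \<bar>f t - f s\<bar> < \<epsilon> / 2"
      using equi t \<open>\<epsilon> > 0\<close> unfolding g_equicontinuous_def by (meson half_gt_zero)
    have "variation g {t..b} < \<infinity>"
      using g t variation_mono[of "{t..b}" "{a..b}" g] by (auto simp: BV_left_def)
    moreover have "(g \<longlongrightarrow> g t) (at_right t)"
      using BV_left_tendsto_at_right[OF g] t 3 by auto
    ultimately obtain r where r: "t < r" "r \<le> b" "variation g {t..r} < ennreal \<delta>"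
      using variation_small_at_right[of t b g \<delta>] 3 \<open>\<delta> > 0\<close> by auto
    have near: "\<bar>f t - f x\<bar> < \<epsilon> / 2" if "f \<in> S" "x \<in> {t..<r}" for f x
    proof (rule \<delta>)
      have "closed_segment t x \<subseteq> {t..r}" using that by (auto simp: closed_segment_eq_real_ivl)
      from variation_mono[OF this] r(3)
      show "variation g (closed_segment t x) < ennreal \<delta>" by (rule order_le_less_trans)
    qed (use that t r in auto)
    show ?thesis
    proof (rule that[of r "{{t..<r}}"])
      fix f X x y assume "f \<in> S" "X \<in> {{t..<r}}" "x \<in> X" "y \<in> X"
      then have "\<bar>f t - f x\<bar> < \<epsilon> / 2" "\<bar>f t - f y\<bar> < \<epsilon> / 2" using near by simp_all
      then show "\<bar>f x - f y\<bar> < \<epsilon>" by linarith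
    qed (use r t in auto)
  qed
qed

lemma equicontinuous_stable_imp_finite_covers:
  fixes S :: "(real \<Rightarrow> real) set"
  assumes g: "g \<in> BV_left a b" and equi: "g_equicontinuous a b g S"
    and stable: "g_stable a b g S" and "\<epsilon> > 0"
  shows "\<exists>\<X>. finite \<X> \<and> \<Union>\<X> = {a..b} \<and>
    (\<forall>f\<in>S. \<forall>X\<in>\<X>. \<forall>x\<in>X. \<forall>y\<in>X. \<bar>f x - f y\<bar> < \<epsilon>)"
proof -
  define good where "good \<X> \<longleftrightarrow> finite \<X> \<and> \<Union>\<X> \<subseteq> {a..b} \<and>
    (\<forall>f\<in>S. \<forall>X\<in>\<X>. \<forall>x\<in>X. \<forall>y\<in>X. \<bar>f x - f y\<bar> < \<epsilon>)" for \<X>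
  have "\<exists>U \<X>. open U \<and> t \<in> U \<and> U \<inter> {a..b} \<subseteq> \<Union>\<X> \<and> good \<X>" if t: "t \<in> {a..b}" for t
  proof -
    obtain p where p: "p < t" "\<And>f x y. \<lbrakk>f \<in> S; x \<in> {p<..t} \<inter> {a..b}; y \<in> {p<..t} \<inter> {a..b}\<rbrakk>
        \<Longrightarrow> \<bar>f x - f y\<bar> < \<epsilon>"
      using small_oscillation_at_left[OF g equi t \<open>\<epsilon> > 0\<close>] by metis
    obtain q \<X> where q: "t < q" "finite \<X>" "\<Union>\<X> \<subseteq> {a..b}" "{t..<q} \<inter> {a..b} \<subseteq> \<Union>\<X>"
      "\<And>f X x y. \<lbrakk>f \<in> S; X \<in> \<X>; x \<in> X; y \<in> X\<rbrakk> \<Longrightarrow> \<bar>f x - f y\<bar> < \<epsilon>"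
      using finite_cover_at_right[OF g equi stable t \<open>\<epsilon> > 0\<close>] by metis
    have "good (insert ({p<..t} \<inter> {a..b}) \<X>)"
      unfolding good_def
    proof (intro conjI ballI)
      fix f X x y
      assume "f \<in> S" "X \<in> insert ({p<..t} \<inter> {a..b}) \<X>" "x \<in> X" "y \<in> X"
      then show "\<bar>f x - f y\<bar> < \<epsilon>" using p(2) q(5) by blast
    qed (use q in auto)
    moreover have "{p<..<q} \<inter> {a..b} \<subseteq> \<Union>(insert ({p<..t} \<inter> {a..b}) \<X>)"
    proof
      fix x assume x: "x \<in> {p<..<q} \<inter> {a..b}"
      then have "x \<in> {p<..t} \<inter> {a..b} \<or> x \<in> {t..<q} \<inter> {a..b}" by auto
      then show "x \<in> \<Union>(insert ({p<..t} \<inter> {a..b}) \<X>)" using q(4) by blast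
    qed
    ultimately show ?thesis using p(1) q(1)
      by (intro exI[of _ "{p<..<q}"] exI[of _ "insert ({p<..t} \<inter> {a..b}) \<X>"]) auto
  qed
  then obtain U \<X> where U: "\<And>t. t \<in> {a..b} \<Longrightarrow> open (U t)" "\<And>t. t \<in> {a..b} \<Longrightarrow> t \<in> U t"
    and \<X>: "\<And>t. t \<in> {a..b} \<Longrightarrow> U t \<inter> {a..b} \<subseteq> \<Union>(\<X> t)" "\<And>t. t \<in> {a..b} \<Longrightarrow> good (\<X> t)"
    by metis
  have "{a..b} \<subseteq> (\<Union>t\<in>{a..b}. U t)" using U(2) by blast
  then obtain T where T: "T \<subseteq> {a..b}" "finite T" "{a..b} \<subseteq> (\<Union>t\<in>T. U t)"
    using compactE_image[of "{a..b}" "{a..b}" U] U(1) by (metis compact_Icc)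
  have sub: "good (\<X> t)" if "t \<in> T" for t using \<X>(2) T(1) that by blast
  have "finite (\<Union>t\<in>T. \<X> t)" using sub T(2) by (auto simp: good_def)
  moreover have "\<Union>(\<Union>t\<in>T. \<X> t) = {a..b}"
  proof
    show "\<Union>(\<Union>t\<in>T. \<X> t) \<subseteq> {a..b}" using sub by (auto simp: good_def)
    show "{a..b} \<subseteq> \<Union>(\<Union>t\<in>T. \<X> t)"
    proof
      fix x assume x: "x \<in> {a..b}"
      then obtain t where t: "t \<in> T" "x \<in> U t" using T(3) by blast
      then have "x \<in> \<Union>(\<X> t)" using \<X>(1)[of t] x T(1) by blast
      with t show "x \<in> \<Union>(\<Union>t\<in>T. \<X> t)" by blast
    qed
  qed
  moreover have "\<forall>f\<in>S. \<forall>X\<in>(\<Union>t\<in>T. \<X> t). \<forall>x\<in>X. \<forall>y\<in>X. \<bar>f x - f y\<bar> < \<epsilon>"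
    using sub by (auto simp: good_def)
  ultimately show ?thesis by (intro exI[of _ "\<Union>t\<in>T. \<X> t"] conjI)
qed

theorem theorem4p14:
  fixes a b :: real and g :: "real \<Rightarrow> real" and S :: "(real \<Rightarrow> real) set"
  assumes "a \<le> b"
    and "g \<in> CV_left a b"
    and "S \<subseteq> mspace (BC_g a b g)"
  shows "g_precompact a b g S \<longleftrightarrow>
           (\<forall>t\<in>{a..b}. bounded {f t |f. f \<in> S}) \<and>
           g_equicontinuous a b g S \<and>
           g_stable a b g S"
proof -
  have g: "g \<in> BV_left a b" using assms(2) by (simp add: CV_left_def)
  note iff = g_precompact_iff_finite_covers[OF assms(3)]
  show ?thesis
  proof
    assume pre: "g_precompact a b g S"
    have "g_stable a b g S"
      unfolding g_stable_def
    proof (intro ballI allI impI)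
      fix t \<epsilon> :: real assume "\<epsilon> > 0"
      then obtain \<X> where "finite \<X>" "\<Union>\<X> = {a..b}"
        "\<forall>f\<in>S. \<forall>X\<in>\<X>. \<forall>x\<in>X. \<forall>y\<in>X. \<bar>f x - f y\<bar> < \<epsilon>"
        using pre iff by auto
      then show "\<exists>\<delta>>0. \<exists>\<X>. finite \<X> \<and> (\<forall>X\<in>\<X>. X \<subseteq> {a..b}) \<and>
          {t..<t + \<delta>} \<inter> {a..b} \<subseteq> \<Union>\<X> \<and> (\<forall>f\<in>S. \<forall>X\<in>\<X>. \<forall>x\<in>X. \<forall>y\<in>X. \<bar>f x - f y\<bar> < \<epsilon>)"
        \<comment> \<open>The cover is global, so any \<open>\<delta>\<close> will do.\<close>
        by (intro exI[of _ 1] conjI exI[of _ \<X>]) auto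
    qed
    with pre iff g_precompact_imp_g_equicontinuous[OF pre assms(3)]
    show "(\<forall>t\<in>{a..b}. bounded {f t |f. f \<in> S}) \<and> g_equicontinuous a b g S \<and> g_stable a b g S"
      by simp
  next
    assume "(\<forall>t\<in>{a..b}. bounded {f t |f. f \<in> S}) \<and> g_equicontinuous a b g S \<and> g_stable a b g S"
    then show "g_precompact a b g S"
      using iff equicontinuous_stable_imp_finite_covers[OF g] by simp
  qed
qed

end
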